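(* Let $P=\frac1{2^2}\delta_1+\frac12\delta_2+\sum_{j=3}^\infty\frac1{2^j}\delta_j$. The set $\{Av[1,2],Av[3,4],Av[5,\infty)\}$ forms the optimal set of three-means for $P$ with quantization error $V_3(P)=\frac13$.
   Context: $\delta_x$ denotes the Dirac measure at $x\in\mathbb R$. For a Borel probability measure $P$ on $\mathbb R$ and a nonempty finite set $\alpha\subset\mathbb R$, the distortion error is $V(P;\alpha)=\int\min_{a\in\alpha}|x-a|^2\,dP(x)$. The $n$th quantization error is $V_n(P)=\inf\{V(P;\alpha):\alpha\subset\mathbb R,\ 1\le\mathrm{card}(\alpha)\le n\}$. An optimal set of $n$-means for $P$ is a set $\alpha$ with at most $n$ points for which this infimum is attained. With $p_m=P(\{m\})$ and $i\le\ell$ positive integers, $Av[i,\ell]=\frac{\sum_{m=i}^{\ell}p_m m}{\sum_{m=i}^{\ell}p_m}$ and $Av[i,\infty)=\frac{\sum_{m=i}^{\infty}p_m m}{\sum_{m=i}^{\infty}p_m}$. *)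

theory Defs
  imports "HOL-Probability.Probability"
begin

text \<open>The distortion error and the quantization error take values in \<^typ>\<open>ennreal\<close>, so that an
  infinite distortion is not mistaken for a small one (the Bochner integral of a
  non-integrable function is \<open>0\<close>).\<close>

definition distortion :: "real measure \<Rightarrow> real set \<Rightarrow> ennreal" where
  "distortion P \<alpha> = (\<integral>\<^sup>+ x. ennreal (MIN a\<in>\<alpha>. \<bar>x - a\<bar>\<^sup>2) \<partial>P)"

definition quantization_error :: "nat \<Rightarrow> real measure \<Rightarrow> ennreal" where
  "quantization_error n P =
     (INF \<alpha>\<in>{\<alpha>. finite \<alpha> \<and> 1 \<le> card \<alpha> \<and> card \<alpha> \<le> n}. distortion P \<alpha>)"

definition optimal_set_of_means :: "nat \<Rightarrow> real measure \<Rightarrow> real set \<Rightarrow> bool" where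
  "optimal_set_of_means n P \<alpha> \<longleftrightarrow>
     finite \<alpha> \<and> 1 \<le> card \<alpha> \<and> card \<alpha> \<le> n \<and> distortion P \<alpha> = quantization_error n P"

definition Av :: "real measure \<Rightarrow> nat \<Rightarrow> nat \<Rightarrow> real" where
  "Av P i l = (\<Sum>m=i..l. measure P {real m} * real m) / (\<Sum>m=i..l. measure P {real m})"

definition Av_inf :: "real measure \<Rightarrow> nat \<Rightarrow> real" where
  "Av_inf P i = (\<Sum>k. measure P {real (i + k)} * real (i + k)) / (\<Sum>k. measure P {real (i + k)})"

text \<open>\<^term>\<open>return borel x\<close> is the Dirac measure at \<open>x\<close>; the summation index of the series is
  shifted, \<open>j = k + 3\<close>. The lemma \<open>emeasure_dyadic_measure\<close> confirms that the set function passed to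
  \<^const>\<open>measure_of\<close> is a measure (otherwise \<^const>\<open>measure_of\<close> would return the null measure).\<close>

definition dyadic_measure :: "real measure" where
  "dyadic_measure = measure_of UNIV (sets borel) (\<lambda>A.
     ennreal (1 / 2 ^ 2) * emeasure (return borel 1) A
     + ennreal (1 / 2) * emeasure (return borel 2) A
     + (\<Sum>k. ennreal (1 / 2 ^ (k + 3)) * emeasure (return borel (real (k + 3))) A))"

lemma sets_dyadic_measure [simp, measurable_cong]: "sets dyadic_measure = sets borel"
  unfolding dyadic_measure_def
  by (simp add: sets.sigma_sets_eq[of borel, simplified])

lemma space_dyadic_measure [simp]: "space dyadic_measure = UNIV"
  unfolding dyadic_measure_def by simp

lemma emeasure_dyadic_measure:
  assumes "A \<in> sets borel"
  shows "emeasure dyadic_measure A =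
     ennreal (1 / 2 ^ 2) * emeasure (return borel 1) A
     + ennreal (1 / 2) * emeasure (return borel 2) A
     + (\<Sum>k. ennreal (1 / 2 ^ (k + 3)) * emeasure (return borel (real (k + 3))) A)"
proof (rule emeasure_measure_of[OF dyadic_measure_def])
  show "countably_additive (sets dyadic_measure) (\<lambda>A.
     ennreal (1 / 2 ^ 2) * emeasure (return borel 1) A
     + ennreal (1 / 2) * emeasure (return borel 2) A
     + (\<Sum>k. ennreal (1 / 2 ^ (k + 3)) * emeasure (return borel (real (k + 3))) A))"
  proof (rule countably_additiveI)
    fix F :: "nat \<Rightarrow> real set"
    assume F: "range F \<subseteq> sets dyadic_measure" "disjoint_family F"
    have R: "(\<Sum>i. emeasure (return borel x) (F i)) = emeasure (return borel x) (\<Union>i. F i)"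
      for x :: real
      using F by (intro suminf_emeasure) simp_all
    have swap: "(\<Sum>i k. ennreal (1 / 2 ^ (k + 3)) * emeasure (return borel (real (k + 3))) (F i))
      = (\<Sum>k i. ennreal (1 / 2 ^ (k + 3)) * emeasure (return borel (real (k + 3))) (F i))"
      unfolding nn_integral_count_space_nat[symmetric]
      by (rule pair_sigma_finite.Fubini')
         (auto intro!: pair_sigma_finite.intro sigma_finite_measure_count_space)
    show "(\<Sum>i. ennreal (1 / 2 ^ 2) * emeasure (return borel 1) (F i)
        + ennreal (1 / 2) * emeasure (return borel 2) (F i)
        + (\<Sum>k. ennreal (1 / 2 ^ (k + 3)) * emeasure (return borel (real (k + 3))) (F i)))
      = ennreal (1 / 2 ^ 2) * emeasure (return borel 1) (\<Union>(range F))
        + ennreal (1 / 2) * emeasure (return borel 2) (\<Union>(range F))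
        + (\<Sum>k. ennreal (1 / 2 ^ (k + 3)) * emeasure (return borel (real (k + 3))) (\<Union>(range F)))"
      by (simp only: suminf_add[OF summableI summableI, symmetric] swap ennreal_suminf_cmult R)
  qed
qed (use assms in \<open>auto simp: positive_def\<close>)

lemma prob_space_dyadic_measure: "prob_space dyadic_measure"
proof (rule prob_spaceI)
  have "(\<lambda>k. (1 / 2 :: real) ^ Suc k * (1 / 4)) sums (1 * (1 / 4))"
    by (rule sums_mult2) (rule power_half_series)
  then have "(\<lambda>k. 1 / 2 ^ (k + 3) :: real) sums (1 / 4)"
    by (simp add: power_add field_simps)
  then have S: "(\<Sum>k. ennreal (1 / 2 ^ (k + 3))) = ennreal (1 / 4)"
    by (intro suminf_ennreal_eq) auto
  have "emeasure dyadic_measure UNIV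
    = ennreal (1 / 4) + ennreal (1 / 2) + (\<Sum>k. ennreal (1 / 2 ^ (k + 3)))"
    by (subst emeasure_dyadic_measure) simp_all
  also have "\<dots> = 1"
    unfolding S
  proof -
    have "ennreal (a + b + c) = ennreal a + ennreal b + ennreal c"
      if "0 \<le> a" "0 \<le> b" "0 \<le> c" for a b c
      using that by simp
    from this[of "1 / 4" "1 / 2" "1 / 4"]
    show "ennreal (1 / 4) + ennreal (1 / 2) + ennreal (1 / 4) = 1"
      by simp
  qed
  finally show "emeasure dyadic_measure (space dyadic_measure) = 1"
    by simp
qed

end

theory Submission
  imports Defs "HOL-Real_Asymp.Real_Asymp"
begin

text \<open>For \<open>a \<le> b \<le> c\<close> the midpoints \<open>u = (a + b) / 2\<close> and \<open>v = (b + c) / 2\<close> decide which of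
  the three points serves a given atom. Locating \<open>u\<close> among \<open>1, 2, 3\<close> and \<open>v\<close> among
  \<open>3, 4, 5, 6\<close> leaves finitely many cases; in each one, completing the square for a few of the
  finite clusters, or for the tail, bounds the distortion from below. The bound exceeds \<open>1 / 3\<close> except for
  the clusters \<open>{1, 2}\<close>, \<open>{3, 4}\<close>, \<open>{5, 6, \<dots>}\<close>, where the distortion is \<open>1 / 3\<close> plus
  squares that vanish exactly at the three conditional means.\<close>

section \<open>Integrals against the measure as series, and sums over dyadic tails\<close>

definition atom_weight :: "nat \<Rightarrow> real" where
  "atom_weight n = (if n = 0 then 0 else if n = 1 then 1 / 4 else if n = 2 then 1 / 2 else 1 / 2 ^ n)"

lemma atom_weight_simps [simp]:
  "atom_weight 0 = 0" "atom_weight (Suc 0) = 1 / 4" "atom_weight 2 = 1 / 2"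
  "3 \<le> n \<Longrightarrow> atom_weight n = 1 / 2 ^ n"
  by (auto simp: atom_weight_def)

lemma atom_weight_nonneg [simp]: "0 \<le> atom_weight n"
  by (simp add: atom_weight_def)

lemma suminf_shift3_ennreal:
  fixes f :: "nat \<Rightarrow> ennreal"
  shows "(\<Sum>n. f n) = f 0 + f 1 + f 2 + (\<Sum>k. f (k + 3))"
  using suminf_offset[of f 3] by (simp add: summableI numeral_3_eq_3 numeral_2_eq_2 ac_simps)

text \<open>As the image of a weighted counting measure on the naturals, the measure turns every
  integral into a single series over \<open>nat\<close>. The indices 0, 1, 2 are split off because
  their weights 0, 1/4, 1/2 do not follow the pattern 1/2^n.\<close>

lemma dyadic_measure_eq_distr:
  "dyadic_measure =
     distr (density (count_space UNIV) (\<lambda>n. ennreal (atom_weight n))) borel real"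
proof (rule measure_eqI)
  fix A assume "A \<in> sets dyadic_measure"
  then have A: "A \<in> sets borel" by simp
  have "emeasure (distr (density (count_space UNIV) (\<lambda>n. ennreal (atom_weight n))) borel real) A
      = (\<integral>\<^sup>+ n. ennreal (atom_weight n) * indicator A (real n) \<partial>count_space UNIV)"
    using A by (simp add: emeasure_distr emeasure_density indicator_def vimage_def)
  also have "\<dots> = (\<Sum>n. ennreal (atom_weight n) * indicator A (real n))"
    by (rule nn_integral_count_space_nat)
  also have "\<dots> = emeasure dyadic_measure A"
    using A by (subst suminf_shift3_ennreal) (simp add: emeasure_dyadic_measure)
  finally show "emeasure dyadic_measure A =
      emeasure (distr (density (count_space UNIV) (\<lambda>n. ennreal (atom_weight n))) borel real) A" ..
qed simp

lemma nn_integral_dyadic_measure: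
  assumes [measurable]: "f \<in> borel_measurable borel"
  shows "(\<integral>\<^sup>+ x. f x \<partial>dyadic_measure) = (\<Sum>n. ennreal (atom_weight n) * f (real n))"
  unfolding dyadic_measure_eq_distr
  by (simp add: nn_integral_distr nn_integral_density nn_integral_count_space_nat)

lemma measure_dyadic_measure_atom: "measure dyadic_measure {real m} = atom_weight m"
proof -
  have "emeasure dyadic_measure {real m}
      = (\<integral>\<^sup>+ n. ennreal (atom_weight n) * indicator {m} n \<partial>count_space UNIV)"
    unfolding dyadic_measure_eq_distr
    by (simp add: emeasure_distr emeasure_density vimage_def)
  then show ?thesis
    by (simp add: measure_def)
qed

text \<open>The weights 1/2^m with m >= n have total mass 2/2^n; normalised, they have mean n + 1
  and variance 2. The value is the mass times the sum of the variance and the squared distance from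
  c to the mean.\<close>

lemma sums_quadratic_dyadic_tail:
  fixes c :: real
  shows "(\<lambda>k. (real (k + n) - c)\<^sup>2 / 2 ^ (k + n)) sums (2 / 2 ^ n * (2 + (real n + 1 - c)\<^sup>2))"
proof -
  \<comment> \<open>\<open>F k\<close> is the claimed value with \<open>k + n\<close> in place of
    \<open>n\<close>, that is, the remainder after k terms, so its consecutive differences are the
    terms of the series.\<close>
  define F where "F k = 2 / 2 ^ (k + n) * (2 + (real (k + n) + 1 - c)\<^sup>2)" for k
  have "F \<longlonglongrightarrow> 0"
    unfolding F_def by real_asymp
  then have "(\<lambda>k. F k - F (Suc k)) sums (F 0 - 0)"
    by (rule telescope_sums')
  moreover have "F k - F (Suc k) = (real (k + n) - c)\<^sup>2 / 2 ^ (k + n)" for k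
    unfolding F_def by (simp add: field_simps power2_eq_square)
  ultimately show ?thesis
    by (simp add: F_def)
qed

lemma sums_linear_dyadic_tail:
  "(\<lambda>k. real (k + n) / 2 ^ (k + n)) sums (2 * (real n + 1) / 2 ^ n)"
proof -
  define F where "F k = 2 * (real (k + n) + 1) / 2 ^ (k + n)" for k
  have "F \<longlonglongrightarrow> 0"
    unfolding F_def by real_asymp
  then have "(\<lambda>k. F k - F (Suc k)) sums (F 0 - 0)"
    by (rule telescope_sums')
  moreover have "F k - F (Suc k) = real (k + n) / 2 ^ (k + n)" for k
    unfolding F_def by (simp add: field_simps)
  ultimately show ?thesis
    by (simp add: F_def)
qed

lemma sums_dyadic_tail: "(\<lambda>k. 1 / 2 ^ (k + n)) sums (2 / 2 ^ n :: real)"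
proof -
  define F where "F k = (2 / 2 ^ (k + n) :: real)" for k
  have "F \<longlonglongrightarrow> 0"
    unfolding F_def by real_asymp
  then have "(\<lambda>k. F k - F (Suc k)) sums (F 0 - 0)"
    by (rule telescope_sums')
  moreover have "F k - F (Suc k) = 1 / 2 ^ (k + n)" for k
    unfolding F_def by (simp add: field_simps)
  ultimately show ?thesis
    by (simp add: F_def)
qed

section \<open>The three conditional means\<close>

lemma Av_dyadic_measure_1_2: "Av dyadic_measure 1 2 = 5 / 3"
proof -
  have "{1..2::nat} = {1, 2}" by auto
  then show ?thesis
    unfolding Av_def measure_dyadic_measure_atom by simp
qed

lemma Av_dyadic_measure_3_4: "Av dyadic_measure 3 4 = 10 / 3"
proof -
  have "{3..4::nat} = {3, 4}" by auto
  then show ?thesis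
    unfolding Av_def measure_dyadic_measure_atom by simp
qed

text \<open>From 3 on the weights are exactly 1/2^m, so the quotient is the mean of a geometric law
  shifted by n.\<close>

lemma Av_inf_dyadic_measure:
  assumes "3 \<le> n"
  shows "Av_inf dyadic_measure n = real n + 1"
proof -
  have "(\<Sum>k. atom_weight (n + k) * real (n + k)) = 2 * (real n + 1) / 2 ^ n"
    using sums_linear_dyadic_tail[of n, THEN sums_unique] assms by (simp add: add.commute)
  moreover have "(\<Sum>k. atom_weight (n + k)) = 2 / 2 ^ n"
    using sums_dyadic_tail[of n, THEN sums_unique] assms by (simp add: add.commute)
  ultimately show ?thesis
    unfolding Av_inf_def measure_dyadic_measure_atom by simp
qed

section \<open>Nearest-point costs and the distortion of a triple\<close>

definition min_sq_dist :: "real \<Rightarrow> real \<Rightarrow> real \<Rightarrow> real \<Rightarrow> real" where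
  "min_sq_dist a b c x = min ((x - a)\<^sup>2) (min ((x - b)\<^sup>2) ((x - c)\<^sup>2))"

lemma min_sq_dist_nonneg [simp]: "0 \<le> min_sq_dist a b c x"
  by (simp add: min_sq_dist_def)

text \<open>The difference of the two squares is affine in x and vanishes at the midpoint. Both
  claims include the midpoint, so a tie may be assigned to either side.\<close>

lemma sq_dist_le_midpoint:
  fixes p q x :: real
  assumes "p \<le> q"
  shows "x \<le> (p + q) / 2 \<Longrightarrow> (x - p)\<^sup>2 \<le> (x - q)\<^sup>2"
    and "(p + q) / 2 \<le> x \<Longrightarrow> (x - q)\<^sup>2 \<le> (x - p)\<^sup>2"
proof -
  have *: "(x - q)\<^sup>2 - (x - p)\<^sup>2 = 2 * (q - p) * ((p + q) / 2 - x)"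
    by (simp add: field_simps power2_eq_square)
  show "(x - p)\<^sup>2 \<le> (x - q)\<^sup>2" if "x \<le> (p + q) / 2"
  proof -
    have "0 \<le> 2 * (q - p) * ((p + q) / 2 - x)"
      using assms that by (intro mult_nonneg_nonneg) auto
    with * show ?thesis by linarith
  qed
  show "(x - q)\<^sup>2 \<le> (x - p)\<^sup>2" if "(p + q) / 2 \<le> x"
  proof -
    have "2 * (q - p) * ((p + q) / 2 - x) \<le> 0"
      using assms that by (intro mult_nonneg_nonpos) auto
    with * show ?thesis by linarith
  qed
qed

context
  fixes a b c :: real
  assumes ab: "a \<le> b" and bc: "b \<le> c"
begin

lemma min_sq_dist_left: "x \<le> (a + b) / 2 \<Longrightarrow> min_sq_dist a b c x = (x - a)\<^sup>2"
  using sq_dist_le_midpoint(1)[OF ab, of x] sq_dist_le_midpoint(1)[of a c x] ab bc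
  by (simp add: min_sq_dist_def)

lemma min_sq_dist_middle:
  "(a + b) / 2 \<le> x \<Longrightarrow> x \<le> (b + c) / 2 \<Longrightarrow> min_sq_dist a b c x = (x - b)\<^sup>2"
  using sq_dist_le_midpoint(2)[OF ab, of x] sq_dist_le_midpoint(1)[OF bc, of x]
  by (simp add: min_sq_dist_def)

lemma min_sq_dist_right: "(b + c) / 2 \<le> x \<Longrightarrow> min_sq_dist a b c x = (x - c)\<^sup>2"
  using sq_dist_le_midpoint(2)[of a c x] sq_dist_le_midpoint(2)[OF bc, of x] ab bc
  by (simp add: min_sq_dist_def)

end

definition dyadic_tail :: "real \<Rightarrow> real \<Rightarrow> real \<Rightarrow> nat \<Rightarrow> real" where
  "dyadic_tail a b c n = (\<Sum>k. min_sq_dist a b c (real (k + n)) / 2 ^ (k + n))"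

lemma summable_dyadic_tail: "summable (\<lambda>k. min_sq_dist a b c (real (k + n)) / 2 ^ (k + n))"
proof (rule summable_comparison_test')
  \<comment> \<open>The minimum is at most the cost of serving every atom by \<open>c\<close>
    alone.\<close>
  show "summable (\<lambda>k. (real (k + n) - c)\<^sup>2 / 2 ^ (k + n))"
    by (rule sums_summable[OF sums_quadratic_dyadic_tail])
qed (auto simp: min_sq_dist_def intro!: divide_right_mono)

lemma dyadic_tail_nonneg: "0 \<le> dyadic_tail a b c n"
  unfolding dyadic_tail_def by (intro suminf_nonneg summable_dyadic_tail) simp

lemma dyadic_tail_Suc:
  "dyadic_tail a b c n = min_sq_dist a b c (real n) / 2 ^ n + dyadic_tail a b c (Suc n)"
  unfolding dyadic_tail_def
  using suminf_split_head[OF summable_dyadic_tail[of a b c n]] by simp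

text \<open>No atom from \<open>n\<close> on lies to the left of the midpoint of \<open>b\<close>
  and \<open>c\<close>, so \<open>c\<close> serves the whole tail and the quadratic closed form
  applies.\<close>

lemma dyadic_tail_right:
  assumes "a \<le> b" "b \<le> c" "(b + c) / 2 \<le> real n"
  shows "dyadic_tail a b c n = 2 / 2 ^ n * (2 + (real n + 1 - c)\<^sup>2)"
proof -
  have "min_sq_dist a b c (real (k + n)) = (real (k + n) - c)\<^sup>2" for k
    using assms by (intro min_sq_dist_right) auto
  then show ?thesis
    unfolding dyadic_tail_def by (simp only: sums_unique[OF sums_quadratic_dyadic_tail, symmetric])
qed

definition dyadic_distortion :: "real \<Rightarrow> real \<Rightarrow> real \<Rightarrow> real" where
  "dyadic_distortion a b c =
     min_sq_dist a b c 1 / 4 + min_sq_dist a b c 2 / 2 + dyadic_tail a b c 3"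

text \<open>The series converges for every triple, so the distortion is finite and the rest is real
  arithmetic. Points may coincide, which covers sets of one or two points.\<close>

lemma distortion_dyadic_measure:
  "distortion dyadic_measure {a, b, c} = ennreal (dyadic_distortion a b c)"
proof -
  let ?m = "min_sq_dist a b c"
  have [measurable]: "?m \<in> borel_measurable borel"
    unfolding min_sq_dist_def[abs_def] by measurable
  have "(MIN p\<in>{a, b, c}. \<bar>x - p\<bar>\<^sup>2) = ?m x" for x
    by (simp add: min_sq_dist_def)
  then have "distortion dyadic_measure {a, b, c} = (\<integral>\<^sup>+ x. ennreal (?m x) \<partial>dyadic_measure)"
    unfolding distortion_def by presburger
  also have "\<dots> = (\<Sum>n. ennreal (atom_weight n * ?m (real n)))"
    by (subst nn_integral_dyadic_measure) (simp_all add: ennreal_mult)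
  also have "\<dots> = ennreal (?m 1 / 4) + ennreal (?m 2 / 2)
      + (\<Sum>k. ennreal (?m (real (k + 3)) / 2 ^ (k + 3)))"
    by (subst suminf_shift3_ennreal) simp
  also have "(\<Sum>k. ennreal (?m (real (k + 3)) / 2 ^ (k + 3))) = ennreal (dyadic_tail a b c 3)"
    unfolding dyadic_tail_def
    by (intro suminf_ennreal2 summable_dyadic_tail) simp
  finally show ?thesis
    unfolding dyadic_distortion_def by (simp add: dyadic_tail_nonneg)
qed

section \<open>The lower bound and its equality case\<close>

lemma dyadic_distortion_lower_bound:
  assumes ab: "a \<le> b" and bc: "b \<le> c"
  shows "1 / 3 \<le> dyadic_distortion a b c"
    and "dyadic_distortion a b c = 1 / 3 \<Longrightarrow> a = 5 / 3 \<and> b = 10 / 3 \<and> c = 6"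
proof -
  let ?m = "min_sq_dist a b c" and ?T = "dyadic_tail a b c" and ?D = "dyadic_distortion a b c"
  define u v where "u = (a + b) / 2" and "v = (b + c) / 2"
  have "u \<le> v" using ab bc by (simp add: u_def v_def)
  note L = min_sq_dist_left[OF ab bc, folded u_def]
  note M = min_sq_dist_middle[OF ab bc, folded u_def v_def]
  note R = dyadic_tail_right[OF ab bc, folded v_def]
  \<comment> \<open>The same distortion with more and more atoms split off; each case below uses the
    expansion whose remaining tail matches its tail bound.\<close>
  have D3: "?D = ?m 1 / 4 + ?m 2 / 2 + ?T 3"
    by (simp add: dyadic_distortion_def)
  have D4: "?D = ?m 1 / 4 + ?m 2 / 2 + ?m 3 / 8 + ?T 4"
    using D3 dyadic_tail_Suc[of a b c 3] by simp
  have D5: "?D = ?m 1 / 4 + ?m 2 / 2 + ?m 3 / 8 + ?m 4 / 16 + ?T 5"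
    using D4 dyadic_tail_Suc[of a b c 4] by simp
  have D6: "?D = ?m 1 / 4 + ?m 2 / 2 + ?m 3 / 8 + ?m 4 / 16 + ?m 5 / 32 + ?T 6"
    using D5 dyadic_tail_Suc[of a b c 5] by simp
  have D7: "?D = ?m 1 / 4 + ?m 2 / 2 + ?m 3 / 8 + ?m 4 / 16 + ?m 5 / 32 + ?m 6 / 64 + ?T 7"
    using D6 dyadic_tail_Suc[of a b c 6] by simp
  have m0: "0 \<le> ?m x" for x by simp
  have T0: "0 \<le> ?T n" for n by (rule dyadic_tail_nonneg)
  have sq_mean: "0 \<le> (x - c)\<^sup>2" for x by simp
  have T3: "1 / 2 \<le> ?T 3" if "v \<le> 3"
  proof -
    have "?T 3 = 1 / 2 + (4 - c)\<^sup>2 / 4"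
      using R[of 3] that by (simp add: add_divide_distrib)
    with sq_mean[of 4] show ?thesis by linarith
  qed
  have T4: "1 / 4 \<le> ?T 4" if "v \<le> 4"
  proof -
    have "?T 4 = 1 / 4 + (5 - c)\<^sup>2 / 8"
      using R[of 4] that by (simp add: add_divide_distrib)
    with sq_mean[of 5] show ?thesis by linarith
  qed
  \<comment> \<open>Kept as an equality, unlike the other tails: this one occurs in the optimal
    configuration, and its square determines \<open>c\<close>.\<close>
  have T5: "?T 5 = 1 / 8 + (c - 6)\<^sup>2 / 16" if "v \<le> 5"
    using R[of 5] that by (simp add: power2_commute add_divide_distrib)
  have T6: "1 / 16 \<le> ?T 6" if "v \<le> 6"
  proof -
    have "?T 6 = 1 / 16 + (7 - c)\<^sup>2 / 32"
      using R[of 6] that by (simp add: add_divide_distrib)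
    with sq_mean[of 7] show ?thesis by linarith
  qed
  \<comment> \<open>In each cluster identity the coefficient of the square is the mass of the
    cluster, its centre is the conditional mean, and the constant is the least cost of serving the
    cluster by one point.\<close>
  have cluster123: "(1 - x)\<^sup>2 / 4 + (2 - x)\<^sup>2 / 2 + (3 - x)\<^sup>2 / 8
      = 5 / 14 + 7 / 8 * (x - 13 / 7)\<^sup>2" for x :: real
    by (simp add: field_simps power2_eq_square)
  have cluster12: "(1 - x)\<^sup>2 / 4 + (2 - x)\<^sup>2 / 2 = 1 / 6 + 3 / 4 * (x - 5 / 3)\<^sup>2" for x :: real
    by (simp add: field_simps power2_eq_square)
  have cluster34: "(3 - x)\<^sup>2 / 8 + (4 - x)\<^sup>2 / 16 = 1 / 24 + 3 / 16 * (x - 10 / 3)\<^sup>2" for x :: real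
    by (simp add: field_simps power2_eq_square)
  have cluster345: "(3 - x)\<^sup>2 / 8 + (4 - x)\<^sup>2 / 16 + (5 - x)\<^sup>2 / 32
      = 13 / 112 + 7 / 32 * (x - 25 / 7)\<^sup>2" for x :: real
    by (simp add: field_simps power2_eq_square)
  have cluster3456: "(3 - x)\<^sup>2 / 8 + (4 - x)\<^sup>2 / 16 + (5 - x)\<^sup>2 / 32 + (6 - x)\<^sup>2 / 64
      = 97 / 480 + 15 / 64 * (x - 56 / 15)\<^sup>2" for x :: real
    by (simp add: field_simps power2_eq_square)
  have cluster23: "(2 - x)\<^sup>2 / 2 + (3 - x)\<^sup>2 / 8 = 1 / 10 + 5 / 8 * (x - 11 / 5)\<^sup>2" for x :: real
    by (simp add: field_simps power2_eq_square)
  have cluster234: "(2 - x)\<^sup>2 / 2 + (3 - x)\<^sup>2 / 8 + (4 - x)\<^sup>2 / 16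
      = 25 / 88 + 11 / 16 * (x - 26 / 11)\<^sup>2" for x :: real
    by (simp add: field_simps power2_eq_square)
  have cluster2345: "(2 - x)\<^sup>2 / 2 + (3 - x)\<^sup>2 / 8 + (4 - x)\<^sup>2 / 16 + (5 - x)\<^sup>2 / 32
      = 181 / 368 + 23 / 32 * (x - 57 / 23)\<^sup>2" for x :: real
    by (simp add: field_simps power2_eq_square)
  note sq = zero_le_power2[of "a - _"] zero_le_power2[of "b - _"]
  \<comment> \<open>Both conclusions follow from this dichotomy: the strict alternative is ruled out
    once the distortion equals 1/3.\<close>
  have cases: "?D > 1 / 3 \<or>
    ?D = 1 / 3 + 3 / 4 * (a - 5 / 3)\<^sup>2 + 3 / 16 * (b - 10 / 3)\<^sup>2 + (c - 6)\<^sup>2 / 16"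
  proof -
    consider "v \<le> 3" | "3 \<le> u" | "u < 1" "3 < v" | "1 \<le> u" "u < 2" "3 < v" | "2 \<le> u" "u < 3" "3 < v"
      by linarith
    then show ?thesis
    proof cases
      case 1
      show ?thesis using D3 T3[OF 1] m0[of 1] m0[of 2] by linarith
    next
      case 2
      \<comment> \<open>One point serves 1, 2 and 3, and the cost 5/14 of that cluster alone exceeds
        1/3. The next case is the same with \<open>b\<close> in place of \<open>a\<close>.\<close>
      have m: "?m 1 = (1 - a)\<^sup>2" "?m 2 = (2 - a)\<^sup>2" "?m 3 = (3 - a)\<^sup>2"
        using 2 by (simp_all add: L)
      show ?thesis
        using D4 m cluster123[of a] sq(1)[of "13 / 7"] T0[of 4] by linarith
    next
      case 3
      have m: "?m 1 = (1 - b)\<^sup>2" "?m 2 = (2 - b)\<^sup>2" "?m 3 = (3 - b)\<^sup>2"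
        using 3 by (simp_all add: M)
      show ?thesis
        using D4 m cluster123[of b] sq(2)[of "13 / 7"] T0[of 4] by linarith
    next
      case 4
      note u = 4
      \<comment> \<open>The cluster of \<open>b\<close> starts at 2, and the cost of atom 1 is
        dropped. The three bounds 1/10 + 1/4, 25/88 + 1/8 and 181/368 all exceed 1/3.\<close>
      consider "v \<le> 4" | "4 < v" "v \<le> 5" | "5 < v"
        by linarith
      then show ?thesis
      proof cases
        case 1
        have m: "?m 2 = (2 - b)\<^sup>2" "?m 3 = (3 - b)\<^sup>2"
          using u 1 by (simp_all add: M)
        show ?thesis
          using D4 m cluster23[of b] sq(2)[of "11 / 5"] m0[of 1] T4[OF 1] by linarith
      next
        case 2
        have m: "?m 2 = (2 - b)\<^sup>2" "?m 3 = (3 - b)\<^sup>2" "?m 4 = (4 - b)\<^sup>2"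
          using u 2 by (simp_all add: M)
        show ?thesis
          using D5 m cluster234[of b] sq(2)[of "26 / 11"] m0[of 1] T5[OF 2(2)]
            zero_le_power2[of "c - 6"] by linarith
      next
        case 3
        have m: "?m 2 = (2 - b)\<^sup>2" "?m 3 = (3 - b)\<^sup>2" "?m 4 = (4 - b)\<^sup>2" "?m 5 = (5 - b)\<^sup>2"
          using u 3 by (simp_all add: M)
        show ?thesis
          using D6 m cluster2345[of b] sq(2)[of "57 / 23"] m0[of 1] T0[of 6]
          by linarith
      qed
    next
      case 5
      note u = 5
      \<comment> \<open>Now \<open>a\<close> serves 1 and 2, at cost at least 1/6. The four bounds
        are 5/12, 1/3, 29/84 and 59/160. The split at 6 supplies the tail bound 1/16, without which
        the clusters {1, 2} and {3, 4, 5} give less than 1/3.\<close>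
      consider "v \<le> 4" | "4 < v" "v \<le> 5" | "5 < v" "v \<le> 6" | "6 < v"
        by linarith
      then show ?thesis
      proof cases
        case 1
        have m: "?m 1 = (1 - a)\<^sup>2" "?m 2 = (2 - a)\<^sup>2"
          using u 1 by (simp_all add: L)
        show ?thesis
          using D4 m cluster12[of a] sq(1)[of "5 / 3"] m0[of 3] T4[OF 1] by linarith
      next
        case 2
        \<comment> \<open>The equality branch: 1/6 + 1/24 + 1/8 = 1/3, with all three squares
          retained.\<close>
        have m: "?m 1 = (1 - a)\<^sup>2" "?m 2 = (2 - a)\<^sup>2" "?m 3 = (3 - b)\<^sup>2" "?m 4 = (4 - b)\<^sup>2"
          using u 2 by (simp_all add: L M)
        show ?thesis
          using D5 m cluster12[of a] cluster34[of b] T5[OF 2(2)] by linarith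
      next
        case 3
        have m: "?m 1 = (1 - a)\<^sup>2" "?m 2 = (2 - a)\<^sup>2" "?m 3 = (3 - b)\<^sup>2" "?m 4 = (4 - b)\<^sup>2" "?m 5 = (5 - b)\<^sup>2"
          using u 3 by (simp_all add: L M)
        show ?thesis
          using D6 m cluster12[of a] cluster345[of b] T6[OF 3(2)]
            sq(1)[of "5 / 3"] sq(2)[of "25 / 7"] by linarith
      next
        case 4
        have m: "?m 1 = (1 - a)\<^sup>2" "?m 2 = (2 - a)\<^sup>2" "?m 3 = (3 - b)\<^sup>2" "?m 4 = (4 - b)\<^sup>2" "?m 5 = (5 - b)\<^sup>2"
            "?m 6 = (6 - b)\<^sup>2"
          using u 4 by (simp_all add: L M)
        show ?thesis
          using D7 m cluster12[of a] cluster3456[of b]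
            T0[of 7] sq(1)[of "5 / 3"] sq(2)[of "56 / 15"] by linarith
      qed
    qed
  qed
  note squares = sq(1)[of "5 / 3"] sq(2)[of "10 / 3"] zero_le_power2[of "c - 6"]
  show "1 / 3 \<le> ?D"
    using cases squares by linarith
  assume "?D = 1 / 3"
  with cases have "3 / 4 * (a - 5 / 3)\<^sup>2 + 3 / 16 * (b - 10 / 3)\<^sup>2 + (c - 6)\<^sup>2 / 16 = 0"
    by linarith
  with squares have "(a - 5 / 3)\<^sup>2 \<le> 0 \<and> (b - 10 / 3)\<^sup>2 \<le> 0 \<and> (c - 6)\<^sup>2 \<le> 0"
    by linarith
  then show "a = 5 / 3 \<and> b = 10 / 3 \<and> c = 6"
    by (simp only: power2_less_eq_zero_iff right_minus_eq)
qed

section \<open>Attainment of the bound, and passage to arbitrary finite sets\<close>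

lemma dyadic_distortion_opt: "dyadic_distortion (5 / 3) (10 / 3) 6 = 1 / 3"
proof -
  have expand: "dyadic_distortion a b c = min_sq_dist a b c 1 / 4 + min_sq_dist a b c 2 / 2
      + min_sq_dist a b c 3 / 8 + min_sq_dist a b c 4 / 16 + dyadic_tail a b c 5" for a b c
    using dyadic_tail_Suc[of a b c 3] dyadic_tail_Suc[of a b c 4]
    by (simp add: dyadic_distortion_def)
  \<comment> \<open>The midpoint 14/3 lies below 5, and 6 is the mean of the tail, so only the
    variance term remains.\<close>
  have "dyadic_tail (5 / 3) (10 / 3) 6 5 = 1 / 8"
    by (subst dyadic_tail_right) simp_all
  then show ?thesis
    unfolding expand by (simp add: min_sq_dist_def power2_eq_square)
qed

text \<open>Repeating points turns every competitor into a sorted triple, the form that the lower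
  bound requires.\<close>

lemma obtain_three_sorted:
  fixes A :: "'a::linorder set"
  assumes "finite A" "1 \<le> card A" "card A \<le> 3"
  obtains a b c where "A = {a, b, c}" "a \<le> b" "b \<le> c"
proof -
  define xs where "xs = sorted_list_of_set A"
  have xs: "set xs = A" "sorted xs" "length xs = card A"
    using assms by (simp_all add: xs_def)
  with assms consider "length xs = 1" | "length xs = 2" | "length xs = 3"
    by linarith
  then show thesis
  proof cases
    case 1
    then obtain x where "xs = [x]" by (auto simp: length_Suc_conv)
    with xs that[of x x x] show thesis by auto
  next
    case 2
    then obtain x y where "xs = [x, y]" by (auto simp: numeral_2_eq_2 length_Suc_conv)
    with xs that[of x y y] show thesis by auto
  next
    case 3
    then obtain x y z where "xs = [x, y, z]" by (auto simp: numeral_3_eq_3 length_Suc_conv)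
    with xs that[of x y z] show thesis by auto
  qed
qed

theorem proposition4p1p2:
  shows "optimal_set_of_means 3 dyadic_measure
           {Av dyadic_measure 1 2, Av dyadic_measure 3 4, Av_inf dyadic_measure 5}
         \<and> (\<forall>\<beta>. optimal_set_of_means 3 dyadic_measure \<beta> \<longrightarrow>
              \<beta> = {Av dyadic_measure 1 2, Av dyadic_measure 3 4, Av_inf dyadic_measure 5})
         \<and> quantization_error 3 dyadic_measure = 1 / 3"
proof -
  have means: "{Av dyadic_measure 1 2, Av dyadic_measure 3 4, Av_inf dyadic_measure 5}
      = {5 / 3, 10 / 3, 6}"
    by (simp only: Av_dyadic_measure_1_2 Av_dyadic_measure_3_4) (simp add: Av_inf_dyadic_measure)
  have opt: "distortion dyadic_measure {5 / 3, 10 / 3, 6} = ennreal (1 / 3)"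
    by (simp only: distortion_dyadic_measure dyadic_distortion_opt)
  have lower: "ennreal (1 / 3) \<le> distortion dyadic_measure \<alpha>"
    if "finite \<alpha>" "1 \<le> card \<alpha>" "card \<alpha> \<le> 3" for \<alpha>
  proof -
    from that obtain a b c where "\<alpha> = {a, b, c}" "a \<le> b" "b \<le> c"
      by (rule obtain_three_sorted)
    then show ?thesis
      by (simp only: distortion_dyadic_measure) (intro ennreal_leI dyadic_distortion_lower_bound)
  qed
  have error: "quantization_error 3 dyadic_measure = ennreal (1 / 3)"
    unfolding quantization_error_def
  proof (rule antisym)
    show "(INF \<alpha>\<in>{\<alpha>. finite \<alpha> \<and> 1 \<le> card \<alpha> \<and> card \<alpha> \<le> 3}. distortion dyadic_measure \<alpha>)
        \<le> ennreal (1 / 3)"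
      unfolding opt[symmetric] by (rule INF_lower) simp
    show "ennreal (1 / 3) \<le>
        (INF \<alpha>\<in>{\<alpha>. finite \<alpha> \<and> 1 \<le> card \<alpha> \<and> card \<alpha> \<le> 3}. distortion dyadic_measure \<alpha>)"
      using lower by (intro INF_greatest) blast
  qed
  have unique: "\<beta> = {5 / 3, 10 / 3, 6}" if "optimal_set_of_means 3 dyadic_measure \<beta>" for \<beta>
  proof -
    from that have \<beta>: "finite \<beta>" "1 \<le> card \<beta>" "card \<beta> \<le> 3"
        "distortion dyadic_measure \<beta> = ennreal (1 / 3)"
      by (simp_all add: optimal_set_of_means_def error)
    from \<beta>(1-3) obtain a b c where abc: "\<beta> = {a, b, c}" "a \<le> b" "b \<le> c"
      by (rule obtain_three_sorted)
    \<comment> \<open>\<open>ennreal\<close> is injective only on nonnegative reals, so the sign is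
      needed to carry the equality back to the reals.\<close>
    have "0 \<le> dyadic_distortion a b c"
      using dyadic_distortion_lower_bound(1)[OF abc(2,3)] by linarith
    then have "dyadic_distortion a b c = 1 / 3"
      using \<beta>(4) ennreal_inj[of "dyadic_distortion a b c" "1 / 3"]
      by (simp add: abc(1) distortion_dyadic_measure)
    then have "a = 5 / 3 \<and> b = 10 / 3 \<and> c = 6"
      by (rule dyadic_distortion_lower_bound(2)[OF abc(2,3)])
    then show ?thesis
      by (simp only: abc(1))
  qed
  have "optimal_set_of_means 3 dyadic_measure {5 / 3, 10 / 3, 6}"
    unfolding optimal_set_of_means_def opt error by simp
  moreover have "quantization_error 3 dyadic_measure = 1 / 3"
    using error divide_ennreal[of 1 3] by simp
  ultimately show ?thesis
    unfolding means using unique by blast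
qed

end
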